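(* Let $\epsilon\in\{0,1,-1\}$ and $\delta\in\mathbb{R}$. There exists a constant $C_{bnd}>0$, which is $h^\delta$-dependent, such that $$\mathcal{B}_h^{(\epsilon)}(\mathbf{w},\mathbf{v})\le C_{bnd}\,|||\mathbf{w}|||\,|||\mathbf{v}|||\qquad\text{for all }(\mathbf{w},\mathbf{v})\in\mathbf{V}^*\times\mathbf{V}^*,$$ where $C_{bnd}:=\max(2,C_1h^\delta)$ and $C_1:=(\alpha_0C_{tr}^2)^{-1}$ is a constant independent of $h$.
   Context: $\Omega\subset\mathbb{R}^d$, $d\ge2$, is a bounded polyhedral domain with Lipschitz boundary; $\kappa\in[L^\infty(\Omega)]^{d\times d}$ is a bounded, symmetric, uniformly positive-definite matrix-valued function. Meshes. $\{\mathcal{T}_h\}_{h>0}$, $h\le1$, is a shape-regular family of affine triangulations of $\Omega$; $h_T:=\mathrm{diam}(T)$ and $h$ is the largest diameter; the family is quasi-uniform: there is $0<\rho_0\le1$ independent of $h$ with $\rho_0h\le h_T\le h$ for all $T\in\mathcal{T}_h$. $\kappa$ is piecewise constant on $\mathcal{T}_h$, with $\kappa|_T=:\kappa_T$. $\mathcal{F}_h$ is the set of all interfaces ($(d-1)$-dimensional faces), $\mathcal{F}_h^b$ the boundary ones, $\mathcal{F}_T:=\{F\in\mathcal{F}_h:F\subset\partial T\}$, and $\mathbf{n}_{T,F}$ is the unit normal to $F$ pointing out of $T$. $H^2(\mathcal{T}_h)$ is the broken Sobolev space, $\nabla_h$ the broken gradient, $\|\cdot\|_{0,D}$ the $L^2(D)$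 norm, $(\cdot,\cdot)_{\mathcal{T}_h}:=\sum_T(\cdot,\cdot)_{L^2(T)}$ with norm $\|\cdot\|_{0,\mathcal{T}_h}$, and $\langle\cdot,\cdot\rangle_{\partial\mathcal{T}_h}:=\sum_T\langle\cdot,\cdot\rangle_{L^2(\partial T)}$. Spaces. $\mathbf{V}:=\big(H^s_0(\Omega)\cap H^2(\mathcal{T}_h)\big)\times L^2(\mathcal{F}_h)$ with $s>3/2$, where $H^s_0(\Omega)$ denotes functions of $H^s(\Omega)$ with zero trace on $\partial\Omega$. $V_h:=\{v_h\in L^2(\Omega):v_h|_T\in\mathbb{P}_k(T)\ \forall T\in\mathcal{T}_h\}$, $\hat V_h:=\{\hat v_h\in L^2(\mathcal{F}_h):\hat v_h|_F\in\mathbb{P}_k(F)\ \forall F\in\mathcal{F}_h,\ \hat v_h|_F=0\ \forall F\in\mathcal{F}_h^b\}$, $\mathbf{V}_h:=V_h\times\hat V_h$, where $\mathbb{P}_k$ denotes polynomials of degree at most $k$. $\mathbf{V}^*:=\mathbf{V}+\mathbf{V}_h$. For a pair $\mathbf{v}=(v,\hat v)$ the jump on $F\in\mathcal{F}_T$ is $[\![\mathbf{v}]\!]_{T,F}:=(v|_F-\hat v|_F)\,\mathbf{n}_{T,F}$, with $v|_F$ the trace from $T$. Penalty. On $F\in\mathcal{F}_T$, $\tau$ equals $\tau_{T,F}:=\alpha_0C_{tr}^2\kappa_{T,F}/h_T^{1+\delta}$, where $\kappa_{T,F}:=\mathbf{n}_{T,F}\cdot\kappa_T\mathbf{n}_{T,F}$,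 $\alpha_0>0$ is a user-dependent parameter, and $C_{tr}:=\sqrt{(k+1)(k+d)/d}$, which is the value taken (for a $d$-simplex element) for the constant of the discrete trace inequality $\|v_h\|_{0,F}\le C_{tr}h_T^{-1/2}\|v_h\|_{0,T}$, $v_h\in V_h$, $F\in\mathcal{F}_T$. Bilinear form (extended to $\mathbf{V}^*\times\mathbf{V}^*$ by the same formula). $$\mathcal{B}_h^{(\epsilon)}(\mathbf{w},\mathbf{v}):=(\kappa\nabla_hw,\nabla_hv)_{\mathcal{T}_h}+\langle\tau[\![\mathbf{w}]\!],[\![\mathbf{v}]\!]\rangle_{\partial\mathcal{T}_h}-\langle\kappa\nabla_hw,[\![\mathbf{v}]\!]\rangle_{\partial\mathcal{T}_h}-\epsilon\langle\kappa\nabla_hv,[\![\mathbf{w}]\!]\rangle_{\partial\mathcal{T}_h}.$$ Norms. $\|\mathbf{v}\|_*^2:=\|\kappa^{1/2}\nabla_hv\|_{0,\mathcal{T}_h}^2+\sum_{T}\sum_{F\in\mathcal{F}_T}\|\tau_{T,F}^{1/2}[\![\mathbf{v}]\!]\|_{0,F}^2$, and $|||\mathbf{v}|||^2:=\|\mathbf{v}\|_*^2+\sum_Th_T\|\kappa^{1/2}\nabla_hv\|_{0,\partial T}^2$.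
   Formalization: For δ<0 the constant C_1 is multiplied by ρ_0^δ (quasi-uniformity constant), since with the printed C_1 the bound can fail when some h_T<h; for δ≥0, or when all h_T=h, the constant is as printed. *)

theory Defs
  imports "HOL-Analysis.Analysis"
begin

text \<open>
  Functions are representatives of their almost-everywhere classes. Mesh elements are closed
  simplices \<open>T\<close>; volume integrals and Sobolev spaces on an element are taken over \<open>interior T\<close>.
\<close>

section \<open>Square-integrable and Sobolev functions\<close>

definition L2 :: "'b measure \<Rightarrow> ('b \<Rightarrow> real) set" where
  "L2 M = {f \<in> borel_measurable M. integrable M (\<lambda>x. (f x)\<^sup>2)}"

definition classical_partial :: "'d \<Rightarrow> (real^'d \<Rightarrow> real) \<Rightarrow> real^'d \<Rightarrow> real" where
  "classical_partial i f x = frechet_derivative f (at x) (axis i 1)"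

primrec Ck :: "nat \<Rightarrow> (real^'d::finite \<Rightarrow> real) \<Rightarrow> bool" where
  "Ck 0 f \<longleftrightarrow> continuous_on UNIV f"
| "Ck (Suc m) f \<longleftrightarrow> f differentiable_on UNIV \<and> (\<forall>i. Ck m (classical_partial i f))"

definition smooth :: "(real^'d::finite \<Rightarrow> real) \<Rightarrow> bool" where
  "smooth f \<longleftrightarrow> (\<forall>m. Ck m f)"

definition test_function :: "(real^'d::finite) set \<Rightarrow> (real^'d \<Rightarrow> real) \<Rightarrow> bool" where
  "test_function U \<phi> \<longleftrightarrow>
     smooth \<phi> \<and> compact (closure {x. \<phi> x \<noteq> 0}) \<and> closure {x. \<phi> x \<noteq> 0} \<subseteq> U"

definition has_weak_partial ::
    "(real^'d::finite) set \<Rightarrow> 'd \<Rightarrow> (real^'d \<Rightarrow> real) \<Rightarrow> (real^'d \<Rightarrow> real) \<Rightarrow> bool" where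
  "has_weak_partial U i v g \<longleftrightarrow>
     v \<in> L2 (lebesgue_on U) \<and> g \<in> L2 (lebesgue_on U) \<and>
     (\<forall>\<phi>. test_function U \<phi> \<longrightarrow>
        (\<integral>x. v x * classical_partial i \<phi> x \<partial>lebesgue_on U) =
        - (\<integral>x. g x * \<phi> x \<partial>lebesgue_on U))"

text \<open>
  The weak partial derivative in \<open>L\<^sup>2\<close>; it is unique up to null sets, and \<open>0\<close> is a dummy value for
  functions that have none.
\<close>
definition weak_partial ::
    "(real^'d::finite) set \<Rightarrow> 'd \<Rightarrow> (real^'d \<Rightarrow> real) \<Rightarrow> real^'d \<Rightarrow> real" where
  "weak_partial U i v =
     (if \<exists>g. has_weak_partial U i v g then SOME g. has_weak_partial U i v g else (\<lambda>x. 0))"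

definition gagliardo :: "real \<Rightarrow> (real^'d::finite) set \<Rightarrow> (real^'d \<Rightarrow> real) \<Rightarrow> ennreal" where
  "gagliardo \<sigma> U v =
     (\<integral>\<^sup>+x. (\<integral>\<^sup>+y. ennreal ((v x - v y)\<^sup>2 / norm (x - y) powr (real CARD('d) + 2 * \<sigma>))
        \<partial>lebesgue_on U) \<partial>lebesgue_on U)"

text \<open>
  Sobolev--Slobodeckij spaces: all weak derivatives up to order \<open>m\<close> are in \<open>L\<^sup>2\<close> and, if \<open>\<sigma> > 0\<close>,
  those of order \<open>m\<close> have finite Gagliardo seminorm of order \<open>\<sigma>\<close>.
\<close>
primrec sobolev_aux :: "nat \<Rightarrow> real \<Rightarrow> (real^'d::finite) set \<Rightarrow> (real^'d \<Rightarrow> real) set" where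
  "sobolev_aux 0 \<sigma> U = {v \<in> L2 (lebesgue_on U). \<sigma> > 0 \<longrightarrow> gagliardo \<sigma> U v < \<infinity>}"
| "sobolev_aux (Suc m) \<sigma> U = {v. \<forall>i. \<exists>g \<in> sobolev_aux m \<sigma> U. has_weak_partial U i v g}"

definition sobolev :: "real \<Rightarrow> (real^'d::finite) set \<Rightarrow> (real^'d \<Rightarrow> real) set" where
  "sobolev s U = sobolev_aux (nat \<lfloor>s\<rfloor>) (frac s) U"

section \<open>Integration over faces and traces\<close>

definition face_normal :: "(real^'d::finite) set \<Rightarrow> real^'d" where
  "face_normal F = (SOME n. norm n = 1 \<and> (\<forall>x\<in>F. \<forall>y\<in>F. n \<bullet> (x - y) = 0))"

text \<open>
  The \<open>(d-1)\<close>-dimensional surface measure on a \<open>(d-1)\<close>-dimensional convex set \<open>F\<close>: the surface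
  measure of \<open>A \<subseteq> F\<close> is the Lebesgue measure of the right prism of height 1 over \<open>A\<close>. The measure
  lives on the whole space and vanishes off \<open>F\<close>.
\<close>
definition face_measure :: "(real^'d::finite) set \<Rightarrow> (real^'d) measure" where
  "face_measure F =
     (let n = face_normal F; a = (SOME a. a \<in> F) in
      completion (distr (lebesgue_on {x + t *\<^sub>R n | x t. x \<in> F \<and> 0 \<le> t \<and> t \<le> 1}) borel
        (\<lambda>y. y - (n \<bullet> (y - a)) *\<^sub>R n)))"

definition L2_tendsto :: "'b measure \<Rightarrow> (nat \<Rightarrow> 'b \<Rightarrow> real) \<Rightarrow> ('b \<Rightarrow> real) \<Rightarrow> bool" where
  "L2_tendsto M f g \<longleftrightarrow> (\<lambda>n. \<integral>\<^sup>+x. ennreal ((f n x - g x)\<^sup>2) \<partial>M) \<longlonglongrightarrow> 0"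

text \<open>
  The trace is the continuous extension to \<open>H\<^sup>1(U)\<close> of the restriction to \<open>F\<close> of functions that are
  smooth up to the boundary.
\<close>
definition has_face_trace ::
    "(real^'d::finite) set \<Rightarrow> (real^'d) set \<Rightarrow> (real^'d \<Rightarrow> real) \<Rightarrow> (real^'d \<Rightarrow> real) \<Rightarrow> bool" where
  "has_face_trace U F v g \<longleftrightarrow>
     v \<in> sobolev 1 U \<and> g \<in> L2 (face_measure F) \<and>
     (\<exists>\<phi>. (\<forall>n. smooth (\<phi> n)) \<and>
        L2_tendsto (lebesgue_on U) \<phi> v \<and>
        (\<forall>i. L2_tendsto (lebesgue_on U) (\<lambda>n. classical_partial i (\<phi> n)) (weak_partial U i v)) \<and>
        L2_tendsto (face_measure F) \<phi> g)"

text \<open>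
  By the trace theorem the trace exists for every function in \<open>H\<^sup>1\<close> of a simplex; it is unique up
  to null sets, and \<open>0\<close> is a dummy value for functions that have none.
\<close>
definition face_trace ::
    "(real^'d::finite) set \<Rightarrow> (real^'d) set \<Rightarrow> (real^'d \<Rightarrow> real) \<Rightarrow> real^'d \<Rightarrow> real" where
  "face_trace U F v =
     (if \<exists>g. has_face_trace U F v g then SOME g. has_face_trace U F v g else (\<lambda>x. 0))"

section \<open>Domain and meshes\<close>

definition lipschitz_boundary :: "(real^'d::finite) set \<Rightarrow> bool" where
  "lipschitz_boundary \<Omega> \<longleftrightarrow>
     (\<forall>x \<in> frontier \<Omega>. \<exists>r>0. \<exists>e L g. norm e = 1 \<and> L-lipschitz_on UNIV g \<and>
        (\<forall>y \<in> ball x r. y \<in> \<Omega> \<longleftrightarrow> (g (y - (y \<bullet> e) *\<^sub>R e) :: real) < y \<bullet> e))"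

definition polyhedral_lipschitz_domain :: "(real^'d::finite) set \<Rightarrow> bool" where
  "polyhedral_lipschitz_domain \<Omega> \<longleftrightarrow>
     open \<Omega> \<and> connected \<Omega> \<and> \<Omega> \<noteq> {} \<and> bounded \<Omega> \<and>
     (\<exists>\<P>. finite \<P> \<and> (\<forall>P\<in>\<P>. polytope P) \<and> closure \<Omega> = \<Union>\<P>) \<and>
     lipschitz_boundary \<Omega>"

definition simplicial_mesh :: "(real^'d::finite) set \<Rightarrow> (real^'d) set set \<Rightarrow> bool" where
  "simplicial_mesh \<Omega> \<T> \<longleftrightarrow>
     triangulation \<T> \<and> (\<forall>T\<in>\<T>. int CARD('d) simplex T) \<and> \<Union>\<T> = closure \<Omega>"

text \<open>\<open>H\<close> is the set of mesh sizes; the mesh of size \<open>h \<in> H\<close> is \<open>\<T> h\<close>.\<close>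
definition mesh_family ::
    "(real^'d::finite) set \<Rightarrow> real set \<Rightarrow> (real \<Rightarrow> (real^'d) set set) \<Rightarrow> bool" where
  "mesh_family \<Omega> H \<T> \<longleftrightarrow>
     H \<subseteq> {0<..1} \<and> (\<forall>h\<in>H. simplicial_mesh \<Omega> (\<T> h) \<and> h = Max (diameter ` \<T> h))"

definition inscribed_diameter :: "(real^'d::finite) set \<Rightarrow> real" where
  "inscribed_diameter T = Sup {2 * r | r x. 0 \<le> r \<and> cball x r \<subseteq> T}"

definition shape_regular :: "real set \<Rightarrow> (real \<Rightarrow> (real^'d::finite) set set) \<Rightarrow> bool" where
  "shape_regular H \<T> \<longleftrightarrow> (\<exists>c>0. \<forall>h\<in>H. \<forall>T\<in>\<T> h. diameter T \<le> c * inscribed_diameter T)"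

definition quasi_uniform :: "real \<Rightarrow> real set \<Rightarrow> (real \<Rightarrow> (real^'d::finite) set set) \<Rightarrow> bool" where
  "quasi_uniform \<rho>0 H \<T> \<longleftrightarrow>
     0 < \<rho>0 \<and> \<rho>0 \<le> 1 \<and> (\<forall>h\<in>H. \<forall>T\<in>\<T> h. \<rho>0 * h \<le> diameter T \<and> diameter T \<le> h)"

definition faces :: "(real^'d::finite) set set \<Rightarrow> (real^'d) set set" where
  "faces \<T> = {F. \<exists>T\<in>\<T>. F facet_of T}"

definition boundary_faces ::
    "(real^'d::finite) set \<Rightarrow> (real^'d) set set \<Rightarrow> (real^'d) set set" where
  "boundary_faces \<Omega> \<T> = {F \<in> faces \<T>. F \<subseteq> frontier \<Omega>}"

definition faces_of :: "(real^'d::finite) set set \<Rightarrow> (real^'d) set \<Rightarrow> (real^'d) set set" where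
  "faces_of \<T> T = {F \<in> faces \<T>. F \<subseteq> frontier T}"

definition outer_normal :: "(real^'d::finite) set \<Rightarrow> (real^'d) set \<Rightarrow> real^'d" where
  "outer_normal T F =
     (SOME n. norm n = 1 \<and> (\<forall>x\<in>F. \<forall>y\<in>F. n \<bullet> (x - y) = 0) \<and> (\<forall>x\<in>F. \<forall>y\<in>T. n \<bullet> (y - x) \<le> 0))"

section \<open>The coefficient\<close>

definition coefficient :: "(real^'d::finite) set \<Rightarrow> (real^'d \<Rightarrow> real^'d^'d) \<Rightarrow> bool" where
  "coefficient \<Omega> \<kappa> \<longleftrightarrow>
     \<kappa> \<in> borel_measurable (lebesgue_on \<Omega>) \<and>
     (\<exists>M. AE x in lebesgue_on \<Omega>. norm (\<kappa> x) \<le> M) \<and>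
     (AE x in lebesgue_on \<Omega>. transpose (\<kappa> x) = \<kappa> x) \<and>
     (\<exists>m>0. AE x in lebesgue_on \<Omega>. \<forall>\<xi>. m * (norm \<xi>)\<^sup>2 \<le> \<xi> \<bullet> (\<kappa> x *v \<xi>))"

definition piecewise_constant ::
    "(real^'d::finite) set set \<Rightarrow> (real^'d \<Rightarrow> real^'d^'d) \<Rightarrow> bool" where
  "piecewise_constant \<T> \<kappa> \<longleftrightarrow> (\<forall>T\<in>\<T>. \<exists>K. AE x in lebesgue_on (interior T). \<kappa> x = K)"

definition elem_value ::
    "(real^'d::finite \<Rightarrow> real^'d^'d) \<Rightarrow> (real^'d) set \<Rightarrow> real^'d^'d" where
  "elem_value \<kappa> T = (SOME K. AE x in lebesgue_on (interior T). \<kappa> x = K)"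

definition mat_sqrt :: "real^'d^'d \<Rightarrow> real^'d^'d::finite" where
  "mat_sqrt K = (SOME S. transpose S = S \<and> (\<forall>\<xi>. 0 \<le> \<xi> \<bullet> (S *v \<xi>)) \<and> S ** S = K)"

section \<open>Function spaces on the mesh\<close>

definition L2_skeleton :: "(real^'d::finite) set set \<Rightarrow> (real^'d \<Rightarrow> real) set" where
  "L2_skeleton \<T> = {u. \<forall>F \<in> faces \<T>. u \<in> L2 (face_measure F)}"

text \<open>
  Polynomials of total degree at most \<open>k\<close>; \<open>\<alpha>\<close> ranges over multi-indices. The polynomials on a face
  are the restrictions of these.
\<close>
definition polynomials :: "nat \<Rightarrow> (real^'d::finite \<Rightarrow> real) set" where
  "polynomials k =
     {p. \<exists>c. p = (\<lambda>x. \<Sum>\<alpha> | (\<Sum>i\<in>UNIV. \<alpha> i) \<le> k. c (\<alpha> :: 'd \<Rightarrow> nat) * (\<Prod>i\<in>UNIV. (x $ i) ^ \<alpha> i))}"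

definition Hs0 ::
    "real \<Rightarrow> (real^'d::finite) set \<Rightarrow> (real^'d) set set \<Rightarrow> (real^'d \<Rightarrow> real) set" where
  "Hs0 s \<Omega> \<T> = {v \<in> sobolev s \<Omega>. \<forall>F \<in> boundary_faces \<Omega> \<T>. has_face_trace \<Omega> F v (\<lambda>x. 0)}"

definition broken_H2 ::
    "(real^'d::finite) set \<Rightarrow> (real^'d) set set \<Rightarrow> (real^'d \<Rightarrow> real) set" where
  "broken_H2 \<Omega> \<T> = {v \<in> L2 (lebesgue_on \<Omega>). \<forall>T\<in>\<T>. v \<in> sobolev 2 (interior T)}"

definition V_cont ::
    "real \<Rightarrow> (real^'d::finite) set \<Rightarrow> (real^'d) set set
      \<Rightarrow> ((real^'d \<Rightarrow> real) \<times> (real^'d \<Rightarrow> real)) set" where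
  "V_cont s \<Omega> \<T> = (Hs0 s \<Omega> \<T> \<inter> broken_H2 \<Omega> \<T>) \<times> L2_skeleton \<T>"

definition Vh_elem ::
    "nat \<Rightarrow> (real^'d::finite) set \<Rightarrow> (real^'d) set set \<Rightarrow> (real^'d \<Rightarrow> real) set" where
  "Vh_elem k \<Omega> \<T> =
     {v \<in> L2 (lebesgue_on \<Omega>).
        \<forall>T\<in>\<T>. \<exists>p \<in> polynomials k. AE x in lebesgue_on (interior T). v x = p x}"

definition Vh_face ::
    "nat \<Rightarrow> (real^'d::finite) set \<Rightarrow> (real^'d) set set \<Rightarrow> (real^'d \<Rightarrow> real) set" where
  "Vh_face k \<Omega> \<T> =
     {u \<in> L2_skeleton \<T>.
        (\<forall>F \<in> faces \<T>. \<exists>p \<in> polynomials k. AE x in face_measure F. u x = p x) \<and>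
        (\<forall>F \<in> boundary_faces \<Omega> \<T>. AE x in face_measure F. u x = 0)}"

definition V_disc ::
    "nat \<Rightarrow> (real^'d::finite) set \<Rightarrow> (real^'d) set set
      \<Rightarrow> ((real^'d \<Rightarrow> real) \<times> (real^'d \<Rightarrow> real)) set" where
  "V_disc k \<Omega> \<T> = Vh_elem k \<Omega> \<T> \<times> Vh_face k \<Omega> \<T>"

definition V_star ::
    "real \<Rightarrow> nat \<Rightarrow> (real^'d::finite) set \<Rightarrow> (real^'d) set set
      \<Rightarrow> ((real^'d \<Rightarrow> real) \<times> (real^'d \<Rightarrow> real)) set" where
  "V_star s k \<Omega> \<T> =
     {((\<lambda>x. v x + v' x), (\<lambda>x. u x + u' x)) | v u v' u'.
        (v, u) \<in> V_cont s \<Omega> \<T> \<and> (v', u') \<in> V_disc k \<Omega> \<T>}"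

section \<open>Bilinear form and norms\<close>

definition grad :: "(real^'d::finite) set \<Rightarrow> (real^'d \<Rightarrow> real) \<Rightarrow> real^'d \<Rightarrow> real^'d" where
  "grad T v x = (\<chi> i. weak_partial (interior T) i v x)"

definition grad_trace ::
    "(real^'d::finite) set \<Rightarrow> (real^'d) set \<Rightarrow> (real^'d \<Rightarrow> real) \<Rightarrow> real^'d \<Rightarrow> real^'d" where
  "grad_trace T F v x = (\<chi> i. face_trace (interior T) F (weak_partial (interior T) i v) x)"

definition jump ::
    "(real^'d::finite) set \<Rightarrow> (real^'d) set \<Rightarrow> (real^'d \<Rightarrow> real) \<times> (real^'d \<Rightarrow> real)
      \<Rightarrow> real^'d \<Rightarrow> real^'d" where
  "jump T F v x = (face_trace (interior T) F (fst v) x - snd v x) *\<^sub>R outer_normal T F"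

definition C_tr :: "nat \<Rightarrow> nat \<Rightarrow> real" where
  "C_tr k d = sqrt ((real k + 1) * (real k + real d) / real d)"

definition normal_coeff ::
    "(real^'d::finite \<Rightarrow> real^'d^'d) \<Rightarrow> (real^'d) set \<Rightarrow> (real^'d) set \<Rightarrow> real" where
  "normal_coeff \<kappa> T F = outer_normal T F \<bullet> (elem_value \<kappa> T *v outer_normal T F)"

definition penalty ::
    "(real^'d::finite \<Rightarrow> real^'d^'d) \<Rightarrow> nat \<Rightarrow> real \<Rightarrow> real
      \<Rightarrow> (real^'d) set \<Rightarrow> (real^'d) set \<Rightarrow> real" where
  "penalty \<kappa> k \<alpha>0 \<delta> T F =
     \<alpha>0 * (C_tr k CARD('d))\<^sup>2 * normal_coeff \<kappa> T F / diameter T powr (1 + \<delta>)"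

definition B_form ::
    "(real^'d::finite) set set \<Rightarrow> (real^'d \<Rightarrow> real^'d^'d) \<Rightarrow> nat \<Rightarrow> real \<Rightarrow> real \<Rightarrow> real
      \<Rightarrow> (real^'d \<Rightarrow> real) \<times> (real^'d \<Rightarrow> real) \<Rightarrow> (real^'d \<Rightarrow> real) \<times> (real^'d \<Rightarrow> real)
      \<Rightarrow> real" where
  "B_form \<T> \<kappa> k \<alpha>0 \<delta> \<epsilon> w v =
     (\<Sum>T\<in>\<T>. \<integral>x. (\<kappa> x *v grad T (fst w) x) \<bullet> grad T (fst v) x \<partial>lebesgue_on (interior T))
     + (\<Sum>T\<in>\<T>. \<Sum>F\<in>faces_of \<T> T.
          \<integral>x. (penalty \<kappa> k \<alpha>0 \<delta> T F *\<^sub>R jump T F w x) \<bullet> jump T F v x \<partial>face_measure F)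
     - (\<Sum>T\<in>\<T>. \<Sum>F\<in>faces_of \<T> T.
          \<integral>x. (elem_value \<kappa> T *v grad_trace T F (fst w) x) \<bullet> jump T F v x \<partial>face_measure F)
     - \<epsilon> * (\<Sum>T\<in>\<T>. \<Sum>F\<in>faces_of \<T> T.
          \<integral>x. (elem_value \<kappa> T *v grad_trace T F (fst v) x) \<bullet> jump T F w x \<partial>face_measure F)"

definition star_norm ::
    "(real^'d::finite) set set \<Rightarrow> (real^'d \<Rightarrow> real^'d^'d) \<Rightarrow> nat \<Rightarrow> real \<Rightarrow> real
      \<Rightarrow> (real^'d \<Rightarrow> real) \<times> (real^'d \<Rightarrow> real) \<Rightarrow> real" where
  "star_norm \<T> \<kappa> k \<alpha>0 \<delta> v =
     sqrt ((\<Sum>T\<in>\<T>. \<integral>x. (norm (mat_sqrt (\<kappa> x) *v grad T (fst v) x))\<^sup>2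
              \<partial>lebesgue_on (interior T))
         + (\<Sum>T\<in>\<T>. \<Sum>F\<in>faces_of \<T> T.
              \<integral>x. (norm (sqrt (penalty \<kappa> k \<alpha>0 \<delta> T F) *\<^sub>R jump T F v x))\<^sup>2 \<partial>face_measure F))"

definition triple_norm ::
    "(real^'d::finite) set set \<Rightarrow> (real^'d \<Rightarrow> real^'d^'d) \<Rightarrow> nat \<Rightarrow> real \<Rightarrow> real
      \<Rightarrow> (real^'d \<Rightarrow> real) \<times> (real^'d \<Rightarrow> real) \<Rightarrow> real" where
  "triple_norm \<T> \<kappa> k \<alpha>0 \<delta> v =
     sqrt ((star_norm \<T> \<kappa> k \<alpha>0 \<delta> v)\<^sup>2
         + (\<Sum>T\<in>\<T>. diameter T * (\<Sum>F\<in>faces_of \<T> T.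
              \<integral>x. (norm (mat_sqrt (elem_value \<kappa> T) *v grad_trace T F (fst v) x))\<^sup>2
              \<partial>face_measure F)))"

end

theory Submission
  imports Defs
begin

text \<open>
  With \<open>L = max 2 (C\<^sub>1 h\<^sup>\<delta>)\<close>, the penalty satisfies \<open>\<kappa>\<^sub>T\<^sub>,\<^sub>F \<le> L h\<^sub>T \<tau>\<^sub>T\<^sub>,\<^sub>F\<close>, so the consistency terms
  on a face are at most \<open>\<surd>L (c q + c' p)\<close>, where \<open>p, q\<close> are the penalised jumps and \<open>c, c'\<close> the scaled
  conormal gradients of \<open>w, v\<close>. The symmetric form \<open>p q + \<surd>L (c q + c' p)\<close> has norm at most \<open>L\<close>
  exactly when \<open>L \<ge> 2\<close>. All estimates are pointwise weighted inequalities
  \<open>\<dots> \<le> L/2 (t A + B/t)\<close> with a common weight \<open>t > 0\<close>; these are integrated and summed, and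
  optimising over \<open>t\<close> at the very end replaces every use of the Cauchy--Schwarz inequality for
  integrals and sums.
\<close>

section \<open>Square roots of positive definite matrices\<close>

text \<open>The equation for \<open>X\<close> says \<open>(1 - X)\<^sup>2 = 1 - A\<close>; it is solved as a fixed-point problem.\<close>
lemma selfadjoint_contraction_root:
  fixes A :: "'a::{real_inner,banach} \<Rightarrow>\<^sub>L 'a"
  assumes "norm A \<le> r" "r < 1" and selfadj: "\<And>u v. A u \<bullet> v = u \<bullet> A v"
  obtains X :: "'a \<Rightarrow>\<^sub>L 'a" where "norm X \<le> r" "\<And>u v. X u \<bullet> v = u \<bullet> X v" "\<And>u. 2 *\<^sub>R X u = A u + X (X u)"
proof -
  define f where "f X = (1/2) *\<^sub>R (A + (X o\<^sub>L X))" for X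
  \<comment> \<open>Selfadjointness is part of the set on which \<open>f\<close> is iterated, so the
    fixed point inherits it; both conditions are closed, which gives completeness.\<close>
  define S where "S = {X. norm X \<le> r} \<inter> (\<Inter>u v. {X :: 'a \<Rightarrow>\<^sub>L 'a. X u \<bullet> v = u \<bullet> X v})"
  have r0: "0 \<le> r"
    using assms(1) norm_ge_zero order_trans by blast
  have comp: "norm (X o\<^sub>L Y) \<le> norm X * norm Y" for X Y :: "'a \<Rightarrow>\<^sub>L 'a"
    by (rule norm_blinfun_compose)
  have "closed S"
    unfolding S_def by (intro closed_Int closed_INT ballI closed_Collect_le closed_Collect_eq continuous_intros)
  then have "complete S"
    by (simp add: complete_eq_closed)
  moreover have "0 \<in> S"
    using r0 by (simp add: S_def)
  moreover have "f ` S \<subseteq> S"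
  proof clarify
    fix X assume "X \<in> S"
    then have X: "norm X \<le> r" "\<And>u v. X u \<bullet> v = u \<bullet> X v"
      by (auto simp: S_def)
    have "norm (X o\<^sub>L X) \<le> r * r"
      using comp[of X X] X(1) r0 by (meson mult_mono norm_ge_zero order_trans)
    also have "\<dots> \<le> r"
      using r0 assms(2) by (simp add: mult_left_le)
    finally have "norm (A + (X o\<^sub>L X)) \<le> 2 * r"
      using norm_triangle_ineq[of A "X o\<^sub>L X"] assms(1) by linarith
    then show "f X \<in> S"
      by (simp add: S_def f_def selfadj X(2) blinfun.bilinear_simps inner_add_left inner_add_right)
  qed
  moreover have "dist (f X) (f Y) \<le> r * dist X Y" if "X \<in> S" "Y \<in> S" for X Y
  proof -
    have XY: "norm X \<le> r" "norm Y \<le> r"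
      using that by (auto simp: S_def)
    \<comment> \<open>\<open>X\<close> and \<open>Y\<close> need not commute, hence the splitting
      \<open>X X - Y Y = X (X - Y) + (X - Y) Y\<close>. The factor 1/2 in \<open>f\<close> brings
      the Lipschitz constant from \<open>2 r\<close> down to \<open>r\<close>.\<close>
    have "f X - f Y = (1/2) *\<^sub>R ((X o\<^sub>L (X - Y)) + ((X - Y) o\<^sub>L Y))"
      by (simp add: f_def algebra_simps blinfun_eqI blinfun.bilinear_simps)
    moreover have "norm (X o\<^sub>L (X - Y)) \<le> r * norm (X - Y)"
      using comp[of X "X - Y"] XY by (meson mult_right_mono norm_ge_zero order_trans)
    moreover have "norm ((X - Y) o\<^sub>L Y) \<le> norm (X - Y) * r"
      using comp[of "X - Y" Y] XY by (meson mult_left_mono norm_ge_zero order_trans)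
    ultimately show ?thesis
      using norm_triangle_ineq[of "X o\<^sub>L (X - Y)" "(X - Y) o\<^sub>L Y"] by (simp add: dist_norm mult.commute)
  qed
  ultimately have "\<exists>!X\<in>S. f X = X"
    using r0 \<open>r < 1\<close> by (intro Banach_fix) auto
  then obtain X where X: "X \<in> S" "f X = X"
    by blast
  have "2 *\<^sub>R X u = A u + X (X u)" for u
  proof -
    have "2 *\<^sub>R X u = 2 *\<^sub>R f X u"
      using X(2) by simp
    then show ?thesis
      by (simp add: f_def blinfun.bilinear_simps)
  qed
  then show ?thesis
    using X that by (auto simp: S_def)
qed

lemma symmetric_matrix_iff:
  fixes K :: "real^'d^'d"
  shows "transpose K = K \<longleftrightarrow> (\<forall>u v. (K *v u) \<bullet> v = u \<bullet> (K *v v))"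
proof
  assume "\<forall>u v. (K *v u) \<bullet> v = u \<bullet> (K *v v)"
  then have "adjoint ((*v) K) = (*v) K"
    by (intro adjoint_unique) auto
  then show "transpose K = K"
    by (metis adjoint_matrix matrix_of_matrix_vector_mul)
qed (metis dot_lmul_matrix vector_transpose_matrix)

text \<open>For a suitable scalar \<open>c\<close>, \<open>K = c (1 - A)\<close> with
  \<open>norm A < 1\<close>. The fixed point \<open>X\<close> with
  \<open>(1 - X)\<^sup>2 = 1 - A\<close> then makes \<open>sqrt c (1 - X)\<close> a root of
  \<open>K\<close>, and \<open>norm X < 1\<close> makes this root positive.\<close>

lemma mat_sqrt_exists:
  fixes K :: "real^'d^'d"
  assumes sym: "transpose K = K" and "0 < m" and pos: "\<And>\<xi>. m * (norm \<xi>)\<^sup>2 \<le> \<xi> \<bullet> (K *v \<xi>)"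
  obtains S where "transpose S = S" "\<And>\<xi>. 0 \<le> \<xi> \<bullet> (S *v \<xi>)" "S ** S = K"
proof -
  note symK = sym[unfolded symmetric_matrix_iff, rule_format]
  \<comment> \<open>The summand \<open>m\<close> yields \<open>0 < m \<le> M\<close> directly, so
    that \<open>r\<close> below is a real number in \<open>[0, 1)\<close>.\<close>
  define M where "M = onorm ((*v) K) + m"
  have M: "norm (K *v v) \<le> M * norm v" for v
    using onorm[of "(*v) K" v] \<open>0 < m\<close> by (simp add: M_def distrib_right add_increasing2)
  have "m \<le> M"
    using onorm_pos_le[of "(*v) K"] by (simp add: M_def)
  define c where "c = M\<^sup>2 / m" \<comment> \<open>makes \<open>1 - K / c\<close> a contraction\<close>
  have "0 < M" "0 < c"
    using \<open>0 < m\<close> \<open>m \<le> M\<close> by (auto simp: c_def)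
  \<comment> \<open>\<open>r\<^sup>2\<close> is the value of
    \<open>1 - 2 m / c + M\<^sup>2 / c\<^sup>2\<close>, which bounds the squared norm of
    \<open>1 - K / c\<close>.\<close>
  define r where "r = sqrt (1 - (m/M)\<^sup>2)"
  have r: "r\<^sup>2 = 1 - (m/M)\<^sup>2" "0 \<le> r" "r < 1"
    using \<open>0 < m\<close> \<open>m \<le> M\<close> \<open>0 < M\<close> by (auto simp: r_def power_le_one_iff real_sqrt_lt_1_iff)
  define A where "A = Blinfun (\<lambda>v. v - (1/c) *\<^sub>R (K *v v))"
  have A: "blinfun_apply A = (\<lambda>v. v - (1/c) *\<^sub>R (K *v v))"
    unfolding A_def
    by (intro bounded_linear_Blinfun_apply bounded_linear_sub bounded_linear_ident
        bounded_linear_const_scaleR matrix_vector_mul_bounded_linear)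
  have "norm (A v) \<le> r * norm v" for v
  proof -
    have "(norm (A v))\<^sup>2 = (norm v)\<^sup>2 - 2 * (v \<bullet> (K *v v)) / c + (norm (K *v v))\<^sup>2 / c\<^sup>2"
      unfolding A power2_norm_eq_inner using \<open>0 < c\<close>
      by (simp add: inner_diff inner_commute field_simps power2_eq_square)
    also have "\<dots> \<le> (norm v)\<^sup>2 - 2 * (m * (norm v)\<^sup>2) / c + (M * norm v)\<^sup>2 / c\<^sup>2"
      using pos[of v] M[of v] \<open>0 < c\<close>
      by (intro add_mono diff_mono divide_right_mono mult_left_mono power_mono) auto
    also have "\<dots> = (r * norm v)\<^sup>2"
      using \<open>0 < m\<close> \<open>0 < M\<close> unfolding power_mult_distrib r(1) c_def
      by (simp add: field_simps power2_eq_square)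
    finally show ?thesis
      by (rule power2_le_imp_le) (use r(2) in simp)
  qed
  then have "norm A \<le> r"
    using r(2) by (intro norm_blinfun_bound)
  moreover have "A u \<bullet> v = u \<bullet> A v" for u v
    by (simp add: A symK inner_diff)
  ultimately obtain X :: "(real^'d) \<Rightarrow>\<^sub>L (real^'d)" where X: "norm X \<le> r" "\<And>u v. X u \<bullet> v = u \<bullet> X v"
    "\<And>u. 2 *\<^sub>R X u = A u + X (X u)"
    using selfadjoint_contraction_root[OF _ r(3)] by metis
  define T where "T v = sqrt c *\<^sub>R (v - X v)" for v
  define S where "S = matrix T"
  have "linear T"
    unfolding T_def by (intro linearI) (auto simp: blinfun.bilinear_simps algebra_simps)
  then have S: "S *v v = T v" for v
    by (simp add: S_def matrix_works linear_matrix_vector_mul_eq)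
  have "T (T v) = K *v v" for v
  proof -
    have "T (T v) = c *\<^sub>R (v - 2 *\<^sub>R X v + X (X v))"
      using \<open>0 < c\<close> by (simp add: T_def blinfun.bilinear_simps algebra_simps scaleR_2)
    also have "\<dots> = c *\<^sub>R (v - A v)"
      by (simp add: X(3))
    also have "\<dots> = K *v v"
      using \<open>0 < c\<close> by (simp add: A)
    finally show ?thesis .
  qed
  then have "S ** S = K"
    by (simp add: matrix_eq S flip: matrix_vector_mul_assoc)
  moreover have "transpose S = S"
    unfolding symmetric_matrix_iff S T_def by (simp add: X(2) inner_diff)
  moreover have "0 \<le> \<xi> \<bullet> (S *v \<xi>)" for \<xi>
  proof -
    have "\<xi> \<bullet> X \<xi> \<le> norm \<xi> * norm (X \<xi>)"
      by (rule norm_cauchy_schwarz)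
    also have "\<dots> \<le> norm \<xi> * (1 * norm \<xi>)"
      using norm_blinfun[of X \<xi>] X(1) r(3)
      by (intro mult_left_mono order_trans[OF norm_blinfun] mult_right_mono) auto
    finally have "\<xi> \<bullet> X \<xi> \<le> \<xi> \<bullet> \<xi>"
      by (simp add: power2_norm_eq_inner[symmetric] power2_eq_square)
    then show ?thesis
      using \<open>0 < c\<close> by (simp add: S T_def inner_diff)
  qed
  ultimately show ?thesis
    using that by blast
qed

text \<open>Existence of a root makes the choice in \<open>mat_sqrt\<close> a root, and its symmetry
  moves one factor across the inner product. Later estimates use \<open>mat_sqrt\<close> through
  this factorisation.\<close>

lemma mat_sqrt:
  fixes K :: "real^'d^'d"
  assumes "transpose K = K" "0 < m" "\<And>\<xi>. m * (norm \<xi>)\<^sup>2 \<le> \<xi> \<bullet> (K *v \<xi>)"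
  shows "(K *v u) \<bullet> v = (mat_sqrt K *v u) \<bullet> (mat_sqrt K *v v)"
proof -
  let ?P = "\<lambda>S. transpose S = S \<and> (\<forall>\<xi>. 0 \<le> \<xi> \<bullet> (S *v \<xi>)) \<and> S ** S = K"
  have "\<exists>S. ?P S"
    using mat_sqrt_exists[OF assms] by metis
  then have "?P (mat_sqrt K)"
    unfolding mat_sqrt_def by (rule someI_ex)
  then show ?thesis
    by (metis symmetric_matrix_iff matrix_vector_mul_assoc)
qed

section \<open>Outer normals and the interior of the closed domain\<close>

text \<open>\<open>outer_normal\<close> is a choice, so it needs a witness: the normal of a
  hyperplane supporting \<open>T\<close> at a relative interior point of \<open>F\<close>.
  \<open>F\<close> is a general convex part of the frontier because \<open>faces_of\<close> also
  admits facets that come from other elements.\<close>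

lemma outer_normal_unit:
  fixes T F :: "(real^'d::finite) set"
  assumes "convex T" "closed T" "interior T \<noteq> {}" "convex F" "F \<noteq> {}" "F \<subseteq> frontier T"
  shows "norm (outer_normal T F) = 1"
proof -
  obtain z where z: "z \<in> rel_interior F"
    using assms rel_interior_eq_empty by blast
  have "F \<subseteq> T" "z \<in> F"
    using assms frontier_subset_closed z rel_interior_subset by blast+
  have "z \<in> frontier T"
    using \<open>z \<in> F\<close> assms by blast
  then have "z \<in> T" "z \<notin> rel_interior T"
    using assms \<open>z \<in> F\<close> \<open>F \<subseteq> T\<close> by (auto simp: frontier_def rel_interior_nonempty_interior)
  then obtain a where a: "a \<noteq> 0" "\<And>y. y \<in> T \<Longrightarrow> a \<bullet> z \<le> a \<bullet> y"
    using supporting_hyperplane_rel_boundary[OF \<open>convex T\<close>] by metis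
  have eq: "a \<bullet> x = a \<bullet> z" if x: "x \<in> F" for x
  proof (cases "x = z")
    case False
    \<comment> \<open>The segment from \<open>x\<close> to \<open>z\<close> can be prolonged beyond
      \<open>z\<close> inside \<open>F\<close>; since \<open>a\<close> is minimal at
      \<open>z\<close>, it cannot be larger at \<open>x\<close>.\<close>
    obtain e where e: "e > 1" "(1 - e) *\<^sub>R x + e *\<^sub>R z \<in> F"
      using convex_rel_interior_if[OF \<open>convex F\<close> z] hull_inc[OF x] by (meson order_refl)
    then have "a \<bullet> z \<le> (1 - e) * (a \<bullet> x) + e * (a \<bullet> z)"
      using a(2) \<open>F \<subseteq> T\<close> by (fastforce simp: inner_add_right)
    then have "(e - 1) * (a \<bullet> x) \<le> (e - 1) * (a \<bullet> z)"
      by (simp add: algebra_simps)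
    then have "a \<bullet> x \<le> a \<bullet> z"
      using e(1) by simp
    then show ?thesis
      using a(2) that \<open>F \<subseteq> T\<close> by (meson antisym subsetD)
  qed auto
  let ?P = "\<lambda>n. norm n = 1 \<and> (\<forall>x\<in>F. \<forall>y\<in>F. n \<bullet> (x - y) = 0) \<and> (\<forall>x\<in>F. \<forall>y\<in>T. n \<bullet> (y - x) \<le> 0)"
  \<comment> \<open>\<open>a\<close> is minimal over \<open>T\<close> on \<open>F\<close> and so
    points into \<open>T\<close>; the sign turns it outwards.\<close>
  have "?P (- (a /\<^sub>R norm a))"
    using a eq by (auto simp: inner_diff_right field_simps)
  then have "?P (outer_normal T F)"
    unfolding outer_normal_def by (rule someI)
  then show ?thesis
    by blast
qed

text \<open>A Lipschitz domain has no slits: at a boundary point, one side of the graph is an open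
  region that misses \<Omega>, so the closure cannot fill a neighbourhood. Since the elements cover
  only the closure, this is what places their interiors in \<Omega>, where the bounds on \<kappa>
  hold.\<close>

lemma interior_closure_Lipschitz:
  fixes \<Omega> :: "(real^'d::finite) set"
  assumes "open \<Omega>" "lipschitz_boundary \<Omega>"
  shows "interior (closure \<Omega>) \<subseteq> \<Omega>"
proof (rule ccontr)
  assume "\<not> ?thesis"
  then obtain x where x: "x \<in> interior (closure \<Omega>)" "x \<notin> \<Omega>"
    by blast
  then have "x \<in> frontier \<Omega>"
    using assms(1) interior_subset by (auto simp: frontier_def interior_open)
  then obtain r e L g where r: "r > 0" "norm e = 1" "L-lipschitz_on UNIV g"
    and g: "\<And>y. y \<in> ball x r \<Longrightarrow> y \<in> \<Omega> \<longleftrightarrow> (g (y - (y \<bullet> e) *\<^sub>R e) :: real) < y \<bullet> e"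
    using assms(2) unfolding lipschitz_boundary_def by metis
  have cont: "continuous_on UNIV (\<lambda>y. g (y - (y \<bullet> e) *\<^sub>R e))"
    by (intro continuous_on_compose2[OF lipschitz_on_continuous_on[OF r(3)]] continuous_intros) auto
  define U where "U = interior (closure \<Omega>) \<inter> ball x r \<inter> {y. y \<bullet> e < g (y - (y \<bullet> e) *\<^sub>R e)}"
  have "open U"
    unfolding U_def by (intro open_Int open_interior open_ball open_Collect_less cont continuous_intros)
  have "e \<bullet> e = 1"
    using r(2) by (simp add: norm_eq_1)
  obtain d where d: "d > 0" "ball x d \<subseteq> interior (closure \<Omega>)"
    using x(1) open_contains_ball_eq[OF open_interior] by blast
  define t where "t = min d r / 2"
  have t: "t > 0" "t < d" "t < r"
    using d r by (auto simp: t_def)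
  \<comment> \<open>Moving along \<open>- e\<close> keeps the argument of \<open>g\<close> fixed and
    lowers the height, so \<open>y\<close> lies strictly below the graph.\<close>
  define y where "y = x - t *\<^sub>R e"
  have "g (x - (x \<bullet> e) *\<^sub>R e) \<ge> x \<bullet> e"
    using g[of x] x(2) r(1) by simp
  moreover have "y - (y \<bullet> e) *\<^sub>R e = x - (x \<bullet> e) *\<^sub>R e" "y \<bullet> e = x \<bullet> e - t"
    using \<open>e \<bullet> e = 1\<close> by (simp_all add: y_def inner_diff_left algebra_simps)
  moreover have "dist x y = t"
    using r(2) t by (simp add: y_def dist_norm)
  ultimately have "y \<in> U"
    using t d by (auto simp: U_def)
  moreover have "U \<inter> \<Omega> = {}"
    using g by (force simp: U_def)
  ultimately show False
    using \<open>open U\<close> open_Int_closure_eq_empty[of U \<Omega>] interior_subset[of "closure \<Omega>"] by (auto simp: U_def)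
qed

section \<open>Scalar inequalities\<close>

text \<open>Completing the square leaves the remainder \<open>(L - 2) * x\<^sup>2\<close> for one
  sign, which is where \<open>2 \<le> L\<close> enters, and \<open>L * x\<^sup>2\<close> for the
  other.\<close>

lemma quadratic_form_bound:
  fixes L :: real
  assumes "2 \<le> L"
  shows "\<bar>x\<^sup>2 + 2 * sqrt L * (x * y)\<bar> \<le> L * (x\<^sup>2 + y\<^sup>2)"
proof -
  have *: "(sqrt L)\<^sup>2 = L"
    using assms by simp
  have "0 \<le> (sqrt L * y - x)\<^sup>2 + (L - 2) * x\<^sup>2" "0 \<le> (sqrt L * y + x)\<^sup>2 + L * x\<^sup>2"
    using assms by auto
  then show ?thesis
    unfolding power2_diff power2_sum power_mult_distrib * by (simp add: abs_le_iff algebra_simps)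
qed

text \<open>Polarisation of the quadratic bound gives the case \<open>t = 1\<close>. Each product on
  the left pairs one of \<open>p\<close>, \<open>c\<close> with one of \<open>q\<close>,
  \<open>c'\<close>, so scaling the first pair by \<open>sqrt t\<close> and the second by its
  inverse changes only the right-hand side.\<close>

lemma bilinear_form_bound:
  fixes L t :: real
  assumes "2 \<le> L" "0 < t"
  shows "p * q + sqrt L * (c * q + c' * p) \<le> L / 2 * (t * (p\<^sup>2 + c\<^sup>2) + (q\<^sup>2 + c'\<^sup>2) / t)"
proof -
  have *: "2 * (p * q + sqrt L * (c * q + c' * p)) \<le> L * (p\<^sup>2 + c\<^sup>2 + (q\<^sup>2 + c'\<^sup>2))" for p q c c' :: real
    using abs_le_D1[OF quadratic_form_bound[OF assms(1), of "p + q" "c + c'"]]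
      abs_le_D2[OF quadratic_form_bound[OF assms(1), of "p - q" "c - c'"]]
    by (simp add: power2_sum power2_diff algebra_simps)
  define r where "r = sqrt t"
  have r: "r > 0" "t = r\<^sup>2"
    using assms by (auto simp: r_def)
  show ?thesis
    using *[of "r * p" "q / r" "r * c" "c' / r"] r by (simp add: field_simps power2_eq_square)
qed

lemma le_mult_if_le_weighted:
  fixes x a b :: real
  assumes "0 \<le> a" "0 \<le> b" "\<And>t. 0 < t \<Longrightarrow> x \<le> L / 2 * (t * a\<^sup>2 + b\<^sup>2 / t)" "0 \<le> L"
  shows "x \<le> L * a * b"
proof (rule tendsto_lowerbound)
  show "((\<lambda>\<eta>. L * (a + \<eta>) * (b + \<eta>)) \<longlongrightarrow> L * a * b) (at_right 0)"
    by (auto intro!: tendsto_eq_intros)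
  show "\<forall>\<^sub>F \<eta> in at_right 0. x \<le> L * (a + \<eta>) * (b + \<eta>)"
  proof (rule eventually_mono[OF eventually_at_right_less])
    fix \<eta> :: real assume \<eta>: "0 < \<eta>"
    define t where "t = (b + \<eta>) / (a + \<eta>)"
    have "0 < t"
      using assms \<eta> by (simp add: t_def)
    then have "x \<le> L / 2 * (t * a\<^sup>2 + b\<^sup>2 / t)"
      by (rule assms)
    also have "\<dots> \<le> L / 2 * (t * (a + \<eta>)\<^sup>2 + (b + \<eta>)\<^sup>2 / t)"
      using assms \<eta> \<open>0 < t\<close> by (intro mult_left_mono add_mono divide_right_mono power_mono) auto
    also have "\<dots> = L * (a + \<eta>) * (b + \<eta>)"
      using assms \<eta> by (simp add: t_def power2_eq_square)
    finally show "x \<le> L * (a + \<eta>) * (b + \<eta>)" .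
  qed
qed simp

section \<open>Square integrability of the integrands\<close>

lemma L2_zero: "(\<lambda>x. 0) \<in> L2 M"
  by (simp add: L2_def)

lemma integrable_mult_L2:
  assumes "f \<in> L2 M" "g \<in> L2 M"
  shows "integrable M (\<lambda>x. f x * g x)"
proof (rule Bochner_Integration.integrable_bound)
  show "integrable M (\<lambda>x. (f x)\<^sup>2 + (g x)\<^sup>2)"
    using assms by (auto simp: L2_def)
  have "\<bar>a * b\<bar> \<le> a\<^sup>2 + b\<^sup>2" for a b :: real
    using sum_squares_bound[of a b] sum_squares_bound[of a "- b"] zero_le_power2[of a] zero_le_power2[of b]
    by (auto simp: abs_le_iff)
  then show "AE x in M. norm (f x * g x) \<le> norm ((f x)\<^sup>2 + (g x)\<^sup>2)"
    by (simp add: abs_mult)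
qed (use assms in \<open>auto simp: L2_def\<close>)

lemma L2_cmult: "f \<in> L2 M \<Longrightarrow> (\<lambda>x. c * f x) \<in> L2 M"
  by (auto simp: L2_def power_mult_distrib)

lemma L2_add: "f \<in> L2 M \<Longrightarrow> g \<in> L2 M \<Longrightarrow> (\<lambda>x. f x + g x) \<in> L2 M"
  using integrable_mult_L2[of f M g] by (auto simp: L2_def power2_sum mult.assoc)

lemma L2_diff: "f \<in> L2 M \<Longrightarrow> g \<in> L2 M \<Longrightarrow> (\<lambda>x. f x - g x) \<in> L2 M"
  using L2_add[of f M "\<lambda>x. - 1 * g x"] L2_cmult[of g M "- 1"] by simp

lemma L2_sum: "(\<And>i. i \<in> I \<Longrightarrow> f i \<in> L2 M) \<Longrightarrow> (\<lambda>x. \<Sum>i\<in>I. f i x) \<in> L2 M"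
  by (induction I rule: infinite_finite_induct) (auto intro: L2_zero L2_add)

lemma integrable_inner_L2:
  fixes f g :: "'a \<Rightarrow> real^'d::finite"
  assumes "\<And>i. (\<lambda>x. f x $ i) \<in> L2 M" "\<And>i. (\<lambda>x. g x $ i) \<in> L2 M"
  shows "integrable M (\<lambda>x. f x \<bullet> g x)"
  using assms by (auto simp: inner_vec_def intro!: Bochner_Integration.integrable_sum integrable_mult_L2)

lemma L2_matrix_vector_mult:
  fixes f :: "'a \<Rightarrow> real^'d::finite"
  assumes "\<And>i. (\<lambda>x. f x $ i) \<in> L2 M"
  shows "(\<lambda>x. (A *v f x) $ i) \<in> L2 M"
  using assms by (auto simp: matrix_vector_mult_def intro!: L2_sum L2_cmult)

lemma weak_partial_L2: "weak_partial U i v \<in> L2 (lebesgue_on U)"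
proof (cases "\<exists>g. has_weak_partial U i v g")
  case True
  then have "has_weak_partial U i v (weak_partial U i v)"
    unfolding weak_partial_def by (simp add: someI_ex)
  then show ?thesis
    by (simp add: has_weak_partial_def)
qed (simp add: weak_partial_def L2_zero)

lemma face_trace_L2: "face_trace U F v \<in> L2 (face_measure F)"
proof (cases "\<exists>g. has_face_trace U F v g")
  case True
  then have "has_face_trace U F v (face_trace U F v)"
    unfolding face_trace_def by (simp add: someI_ex)
  then show ?thesis
    by (simp add: has_face_trace_def)
qed (simp add: face_trace_def L2_zero)

text \<open>
  Every integrand of the bilinear form and of the norms is integrable on all of
  \<open>V_star\<close>: where a weak derivative or a trace fails to exist, its dummy value \<open>0\<close> is
  square integrable as well.
\<close>
lemma V_star_snd_L2:
  assumes "w \<in> V_star s k \<Omega> \<T>" "F \<in> faces \<T>"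
  shows "snd w \<in> L2 (face_measure F)"
  using assms
  by (auto simp: V_star_def V_cont_def V_disc_def Vh_face_def L2_skeleton_def intro!: L2_add)

section \<open>From the coefficient to its element values\<close>

text \<open>Completeness of Lebesgue measure transfers measurability from \<open>f\<close> to
  \<open>g\<close>. This matters for integrands with \<open>mat_sqrt (\<kappa> x)\<close>, a
  pointwise choice whose measurability is not evident.\<close>

lemma integral_lebesgue_on_cong_AE:
  fixes f g :: "'a::euclidean_space \<Rightarrow> real"
  assumes "U \<in> sets lebesgue" "f \<in> borel_measurable (lebesgue_on U)"
    and "AE x in lebesgue_on U. f x = g x"
  shows "integral\<^sup>L (lebesgue_on U) f = integral\<^sup>L (lebesgue_on U) g"
proof (rule integral_cong_AE)
  have "AE x in lebesgue. x \<in> U \<longrightarrow> f x = g x"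
    using assms AE_restrict_space_iff[of U lebesgue] by simp
  then have "AE x in lebesgue. (if x \<in> U then f x else 0) = (if x \<in> U then g x else 0)"
    by (rule eventually_mono) simp
  then show "g \<in> borel_measurable (lebesgue_on U)"
    using borel_measurable_AE[OF iffD2[OF borel_measurable_if[OF assms(1)] assms(2)]]
      iffD1[OF borel_measurable_if[OF assms(1)]] by fast
qed (use assms in auto)

lemma elem_value_AE:
  assumes "piecewise_constant \<T> \<kappa>" "T \<in> \<T>"
  shows "AE x in lebesgue_on (interior T). \<kappa> x = elem_value \<kappa> T"
proof -
  have "\<exists>K. AE x in lebesgue_on (interior T). \<kappa> x = K"
    using assms by (auto simp: piecewise_constant_def)
  then show ?thesis
    unfolding elem_value_def by (rule someI_ex)
qed

text \<open>On \<open>interior T\<close> the almost-everywhere bounds on \<kappa> become statements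
  that do not depend on the point. A nonempty open set is not a null set, so they hold
  outright.\<close>

lemma elem_value_spd:
  fixes \<kappa> :: "real^'d::finite \<Rightarrow> real^'d^'d"
  assumes "coefficient \<Omega> \<kappa>" "piecewise_constant \<T> \<kappa>" "T \<in> \<T>"
    and "open \<Omega>" "interior T \<subseteq> \<Omega>" "interior T \<noteq> {}"
  obtains m where "transpose (elem_value \<kappa> T) = elem_value \<kappa> T" "0 < m"
    "\<And>\<xi>. m * (norm \<xi>)\<^sup>2 \<le> \<xi> \<bullet> (elem_value \<kappa> T *v \<xi>)"
proof -
  let ?M = "lebesgue_on (interior T)"
  obtain m where m: "m > 0" "AE x in lebesgue_on \<Omega>. \<forall>\<xi>. m * (norm \<xi>)\<^sup>2 \<le> \<xi> \<bullet> (\<kappa> x *v \<xi>)"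
    and sym: "AE x in lebesgue_on \<Omega>. transpose (\<kappa> x) = \<kappa> x"
    using assms(1) by (auto simp: coefficient_def)
  have restrict: "AE x in ?M. P x" if "AE x in lebesgue_on \<Omega>. P x" for P
    using that assms(4,5) by (auto simp: AE_restrict_space_iff borel_open elim: eventually_mono)
  have "AE x in ?M. transpose (elem_value \<kappa> T) = elem_value \<kappa> T \<and>
      (\<forall>\<xi>. m * (norm \<xi>)\<^sup>2 \<le> \<xi> \<bullet> (elem_value \<kappa> T *v \<xi>))"
    using elem_value_AE[OF assms(2,3)] restrict[OF m(2)] restrict[OF sym] by eventually_elim metis
  moreover have "emeasure ?M (space ?M) \<noteq> 0"
    using open_not_negligible[of "interior T"] assms(6)
    by (simp add: emeasure_restrict_space borel_open negligible_iff_emeasure0)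
  then have "ae_filter ?M \<noteq> bot"
    by (simp only: ae_filter_eq_bot_iff not_False_eq_True)
  ultimately show ?thesis
    using that m(1) eventually_happens' by blast
qed

section \<open>Estimates on one element and on one face\<close>

lemma volume_estimate:
  fixes \<kappa> :: "real^'d::finite \<Rightarrow> real^'d^'d" and L t :: real
  assumes "AE x in lebesgue_on (interior T). \<kappa> x = K"
    and S: "\<And>u v. (K *v u) \<bullet> v = (mat_sqrt K *v u) \<bullet> (mat_sqrt K *v v)"
    and "2 \<le> L" "0 < t"
  shows "(\<integral>x. (\<kappa> x *v grad T w x) \<bullet> grad T v x \<partial>lebesgue_on (interior T))
    \<le> L / 2 * (t * (\<integral>x. (norm (mat_sqrt (\<kappa> x) *v grad T w x))\<^sup>2 \<partial>lebesgue_on (interior T))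
       + (\<integral>x. (norm (mat_sqrt (\<kappa> x) *v grad T v x))\<^sup>2 \<partial>lebesgue_on (interior T)) / t)"
proof -
  let ?M = "lebesgue_on (interior T)" and ?S = "mat_sqrt K"
  have grad: "(\<lambda>x. grad T w x $ i) \<in> L2 ?M" for w i
    by (simp add: grad_def weak_partial_L2)
  have int: "integrable ?M (\<lambda>x. (?S *v grad T w x) \<bullet> (?S *v grad T v x))" for w v
    by (intro integrable_inner_L2 L2_matrix_vector_mult grad)
  have norm: "(\<integral>x. (norm (mat_sqrt (\<kappa> x) *v grad T w x))\<^sup>2 \<partial>?M)
      = (\<integral>x. (?S *v grad T w x) \<bullet> (?S *v grad T w x) \<partial>?M)" for w
    using assms(1) borel_measurable_integrable[OF int]
    by (intro integral_lebesgue_on_cong_AE[symmetric])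
      (auto simp: power2_norm_eq_inner borel_open elim: eventually_mono)
  have "(\<integral>x. (\<kappa> x *v grad T w x) \<bullet> grad T v x \<partial>?M)
      = (\<integral>x. (?S *v grad T w x) \<bullet> (?S *v grad T v x) \<partial>?M)"
    using assms(1) borel_measurable_integrable[OF int]
    by (intro integral_lebesgue_on_cong_AE[symmetric]) (auto simp: S borel_open elim: eventually_mono)
  also have "\<dots> \<le> (\<integral>x. L / 2 * (t * ((?S *v grad T w x) \<bullet> (?S *v grad T w x))
      + (?S *v grad T v x) \<bullet> (?S *v grad T v x) / t) \<partial>?M)"
  proof (intro integral_mono)
    fix x
    show "(?S *v grad T w x) \<bullet> (?S *v grad T v x) \<le> L / 2 * (t * ((?S *v grad T w x) \<bullet> (?S *v grad T w x))
      + (?S *v grad T v x) \<bullet> (?S *v grad T v x) / t)"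
      \<comment> \<open>The case \<open>c = c' = 0\<close>; the weight and the constant agree with
        those on the faces, so that the estimates can be added.\<close>
      using bilinear_form_bound[OF assms(3,4), of "norm (?S *v grad T w x)" "norm (?S *v grad T v x)" 0 0]
        norm_cauchy_schwarz[of "?S *v grad T w x" "?S *v grad T v x"]
      by (simp add: power2_norm_eq_inner)
  qed (use int in auto)
  also have "\<dots> = L / 2 * (t * (\<integral>x. (?S *v grad T w x) \<bullet> (?S *v grad T w x) \<partial>?M)
      + (\<integral>x. (?S *v grad T v x) \<bullet> (?S *v grad T v x) \<partial>?M) / t)"
    using int by simp
  finally show ?thesis
    by (simp add: norm)
qed

text \<open>The conormal flux is \<open>(S *v g) \<bullet> (S *v n)\<close>, and the squared norm of
  \<open>S *v n\<close> is \<open>n \<bullet> (K *v n)\<close>, at most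
  \<open>L * D * \<tau>\<close>. Of this bound, \<open>D\<close> is spent on the gradient and \<tau>
  on the jump, which leaves the factor \<open>sqrt L\<close> of
  \<open>bilinear_form_bound\<close>.\<close>

lemma face_pointwise_estimate:
  fixes K S :: "real^'d::finite^'d" and L t D \<tau> \<epsilon> :: real
  assumes S: "\<And>u v. (K *v u) \<bullet> v = (S *v u) \<bullet> (S *v v)"
    and "norm n = 1" "n \<bullet> (K *v n) \<le> L * D * \<tau>" "0 \<le> D" "0 \<le> \<tau>" "2 \<le> L" "0 < t" "\<bar>\<epsilon>\<bar> \<le> 1"
  shows "(\<tau> *\<^sub>R (a *\<^sub>R n)) \<bullet> (b *\<^sub>R n) - (K *v g) \<bullet> (b *\<^sub>R n) - \<epsilon> * ((K *v g') \<bullet> (a *\<^sub>R n))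
    \<le> L / 2 * (t * ((norm (sqrt \<tau> *\<^sub>R (a *\<^sub>R n)))\<^sup>2 + D * (norm (S *v g))\<^sup>2)
        + ((norm (sqrt \<tau> *\<^sub>R (b *\<^sub>R n)))\<^sup>2 + D * (norm (S *v g'))\<^sup>2) / t)"
proof -
  define P where "P a = sqrt \<tau> * \<bar>a\<bar>" for a
  define c where "c g = sqrt D * norm (S *v g)" for g
  have "(norm (S *v n))\<^sup>2 \<le> L * D * \<tau>"
    using assms(3) by (simp add: S power2_norm_eq_inner inner_commute[of n])
  then have Sn: "norm (S *v n) \<le> sqrt L * (sqrt D * sqrt \<tau>)"
    by (simp add: real_le_rsqrt flip: real_sqrt_mult mult.assoc)
  have normal: "\<bar>(K *v g) \<bullet> (b *\<^sub>R n)\<bar> \<le> sqrt L * (c g * P b)" for g b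
  proof -
    have "\<bar>(K *v g) \<bullet> (b *\<^sub>R n)\<bar> = \<bar>b\<bar> * \<bar>(S *v g) \<bullet> (S *v n)\<bar>"
      by (simp add: S abs_mult)
    also have "\<dots> \<le> \<bar>b\<bar> * (norm (S *v g) * (sqrt L * (sqrt D * sqrt \<tau>)))"
      using Cauchy_Schwarz_ineq2[of "S *v g" "S *v n"] Sn
      by (intro mult_left_mono order_trans[OF Cauchy_Schwarz_ineq2]) auto
    finally show ?thesis
      by (simp add: P_def c_def mult_ac)
  qed
  have "\<bar>\<epsilon> * ((K *v g') \<bullet> (a *\<^sub>R n))\<bar> \<le> 1 * \<bar>(K *v g') \<bullet> (a *\<^sub>R n)\<bar>"
    unfolding abs_mult using assms(8) by (intro mult_right_mono) auto
  then have "- \<epsilon> * ((K *v g') \<bullet> (a *\<^sub>R n)) \<le> sqrt L * (c g' * P a)"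
    using normal[of g' a] by linarith
  moreover have "(\<tau> *\<^sub>R (a *\<^sub>R n)) \<bullet> (b *\<^sub>R n) \<le> P a * P b"
  proof -
    have "(\<tau> *\<^sub>R (a *\<^sub>R n)) \<bullet> (b *\<^sub>R n) = \<tau> * (a * b)"
      using assms(2) by (simp add: norm_eq_1)
    also have "\<dots> \<le> \<tau> * \<bar>a * b\<bar>"
      using assms(5) by (intro mult_left_mono) auto
    also have "\<dots> = P a * P b"
      using assms(5) by (simp add: P_def abs_mult)
    finally show ?thesis .
  qed
  ultimately have "(\<tau> *\<^sub>R (a *\<^sub>R n)) \<bullet> (b *\<^sub>R n) - (K *v g) \<bullet> (b *\<^sub>R n) - \<epsilon> * ((K *v g') \<bullet> (a *\<^sub>R n))
    \<le> P a * P b + sqrt L * (c g * P b + c g' * P a)"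
    using normal[of g b] by (simp add: distrib_left)
  also have "\<dots> \<le> L / 2 * (t * ((P a)\<^sup>2 + (c g)\<^sup>2) + ((P b)\<^sup>2 + (c g')\<^sup>2) / t)"
    by (rule bilinear_form_bound[OF assms(6,7)])
  finally show ?thesis
    using assms by (simp add: P_def c_def power_mult_distrib)
qed

lemma face_estimate:
  fixes K S :: "real^'d::finite^'d" and L t D \<tau> \<epsilon> :: real
  assumes S: "\<And>u v. (K *v u) \<bullet> v = (S *v u) \<bullet> (S *v v)"
    and n: "norm (outer_normal T F) = 1" "outer_normal T F \<bullet> (K *v outer_normal T F) \<le> L * D * \<tau>"
    and pos: "0 \<le> D" "0 \<le> \<tau>" "2 \<le> L" "0 < t" "\<bar>\<epsilon>\<bar> \<le> 1"
    and w: "snd w \<in> L2 (face_measure F)" and v: "snd v \<in> L2 (face_measure F)"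
  shows "(\<integral>x. (\<tau> *\<^sub>R jump T F w x) \<bullet> jump T F v x \<partial>face_measure F)
      - (\<integral>x. (K *v grad_trace T F (fst w) x) \<bullet> jump T F v x \<partial>face_measure F)
      - \<epsilon> * (\<integral>x. (K *v grad_trace T F (fst v) x) \<bullet> jump T F w x \<partial>face_measure F)
    \<le> L / 2 * (t * ((\<integral>x. (norm (sqrt \<tau> *\<^sub>R jump T F w x))\<^sup>2 \<partial>face_measure F)
            + D * (\<integral>x. (norm (S *v grad_trace T F (fst w) x))\<^sup>2 \<partial>face_measure F))
          + ((\<integral>x. (norm (sqrt \<tau> *\<^sub>R jump T F v x))\<^sup>2 \<partial>face_measure F)
            + D * (\<integral>x. (norm (S *v grad_trace T F (fst v) x))\<^sup>2 \<partial>face_measure F)) / t)"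
proof -
  let ?M = "face_measure F"
  have trace: "(\<lambda>x. grad_trace T F u x $ i) \<in> L2 ?M" for u i
    by (simp add: grad_trace_def face_trace_L2)
  have jump: "(\<lambda>x. jump T F u x $ i) \<in> L2 ?M" if "snd u \<in> L2 ?M" for u i
    using L2_cmult[OF L2_diff[OF face_trace_L2 that], of "outer_normal T F $ i"]
    by (simp add: jump_def mult.commute)
  have cjump: "(\<lambda>x. (c *\<^sub>R jump T F u x) $ i) \<in> L2 ?M" if "snd u \<in> L2 ?M" for u i c
    using L2_cmult[OF jump[OF that]] by simp
  note int = integrable_inner_L2[OF cjump jump] integrable_inner_L2[OF cjump cjump]
    integrable_inner_L2[OF L2_matrix_vector_mult[OF trace] jump]
    integrable_inner_L2[OF L2_matrix_vector_mult[OF trace] L2_matrix_vector_mult[OF trace]]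
  \<comment> \<open>In order: the penalty product, the two jump norms, the two consistency products
    and the two gradient norms. Their integrability justifies splitting the integrals of
    \<open>?l\<close> and \<open>?r\<close>.\<close>
  note int = int(1)[OF w v, of \<tau>] int(2)[OF w w, of "sqrt \<tau>" "sqrt \<tau>"] int(2)[OF v v, of "sqrt \<tau>" "sqrt \<tau>"]
    int(3)[OF w, of K "fst v"] int(3)[OF v, of K "fst w"] int(4)[of S "fst w" S "fst w"] int(4)[of S "fst v" S "fst v"]
  let ?l = "\<lambda>x. (\<tau> *\<^sub>R jump T F w x) \<bullet> jump T F v x - (K *v grad_trace T F (fst w) x) \<bullet> jump T F v x
      - \<epsilon> * ((K *v grad_trace T F (fst v) x) \<bullet> jump T F w x)"
  let ?r = "\<lambda>x. L / 2 * (t * ((norm (sqrt \<tau> *\<^sub>R jump T F w x))\<^sup>2 + D * (norm (S *v grad_trace T F (fst w) x))\<^sup>2)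
          + ((norm (sqrt \<tau> *\<^sub>R jump T F v x))\<^sup>2 + D * (norm (S *v grad_trace T F (fst v) x))\<^sup>2) / t)"
  have "integral\<^sup>L ?M ?l \<le> integral\<^sup>L ?M ?r"
  proof (intro integral_mono)
    show "integrable ?M ?l"
      by (intro Bochner_Integration.integrable_diff integrable_mult_right int)
    show "integrable ?M ?r"
      unfolding power2_norm_eq_inner
      by (intro Bochner_Integration.integrable_add integrable_mult_right integrable_divide int)
    show "?l x \<le> ?r x" for x
      unfolding jump_def by (rule face_pointwise_estimate[where K = K and S = S, OF S n pos])
  qed
  moreover have "integral\<^sup>L ?M ?l = (\<integral>x. (\<tau> *\<^sub>R jump T F w x) \<bullet> jump T F v x \<partial>?M)
      - (\<integral>x. (K *v grad_trace T F (fst w) x) \<bullet> jump T F v x \<partial>?M)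
      - \<epsilon> * (\<integral>x. (K *v grad_trace T F (fst v) x) \<bullet> jump T F w x \<partial>?M)"
    using int by (simp del: inner_scaleR_left)
  moreover have "integral\<^sup>L ?M ?r = L / 2 * (t * ((\<integral>x. (norm (sqrt \<tau> *\<^sub>R jump T F w x))\<^sup>2 \<partial>face_measure F)
            + D * (\<integral>x. (norm (S *v grad_trace T F (fst w) x))\<^sup>2 \<partial>face_measure F))
          + ((\<integral>x. (norm (sqrt \<tau> *\<^sub>R jump T F v x))\<^sup>2 \<partial>face_measure F)
            + D * (\<integral>x. (norm (S *v grad_trace T F (fst v) x))\<^sup>2 \<partial>face_measure F)) / t)"
    unfolding power2_norm_eq_inner using int by (simp del: inner_scaleR_left inner_scaleR_right)
  ultimately show ?thesis
    by (simp only:)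
qed

section \<open>Summation over the mesh\<close>

lemma B_form_weighted:
  fixes \<T> :: "(real^'d::finite) set set" and L t :: real
  assumes "\<And>T. T \<in> \<T> \<Longrightarrow> AE x in lebesgue_on (interior T). \<kappa> x = elem_value \<kappa> T"
    and S: "\<And>T u v. T \<in> \<T> \<Longrightarrow> (elem_value \<kappa> T *v u) \<bullet> v
        = (mat_sqrt (elem_value \<kappa> T) *v u) \<bullet> (mat_sqrt (elem_value \<kappa> T) *v v)"
    and n: "\<And>T F. T \<in> \<T> \<Longrightarrow> F \<in> faces_of \<T> T \<Longrightarrow> norm (outer_normal T F) = 1"
    and \<tau>: "\<And>T F. T \<in> \<T> \<Longrightarrow> F \<in> faces_of \<T> T \<Longrightarrow>
        normal_coeff \<kappa> T F \<le> L * diameter T * penalty \<kappa> k \<alpha>0 \<delta> T F"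
    and \<tau>0: "\<And>T F. T \<in> \<T> \<Longrightarrow> F \<in> faces_of \<T> T \<Longrightarrow> 0 \<le> penalty \<kappa> k \<alpha>0 \<delta> T F"
    and D: "\<And>T. T \<in> \<T> \<Longrightarrow> 0 \<le> diameter T"
    and "2 \<le> L" "0 < t" "\<bar>\<epsilon>\<bar> \<le> 1"
    and w: "\<And>F. F \<in> faces \<T> \<Longrightarrow> snd w \<in> L2 (face_measure F)"
    and v: "\<And>F. F \<in> faces \<T> \<Longrightarrow> snd v \<in> L2 (face_measure F)"
  shows "B_form \<T> \<kappa> k \<alpha>0 \<delta> \<epsilon> w v
    \<le> L / 2 * (t * (triple_norm \<T> \<kappa> k \<alpha>0 \<delta> w)\<^sup>2 + (triple_norm \<T> \<kappa> k \<alpha>0 \<delta> v)\<^sup>2 / t)"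
proof -
  let ?\<tau> = "penalty \<kappa> k \<alpha>0 \<delta>" and ?K = "elem_value \<kappa>" and ?S = "\<lambda>T. mat_sqrt (elem_value \<kappa> T)"
  define G :: "_ \<Rightarrow> (real^'d \<Rightarrow> real) \<times> (real^'d \<Rightarrow> real) \<Rightarrow> real" where "G T w = (\<integral>x. (norm (mat_sqrt (\<kappa> x) *v grad T (fst w) x))\<^sup>2 \<partial>lebesgue_on (interior T))" for T w
  define J where "J T F w = (\<integral>x. (norm (sqrt (?\<tau> T F) *\<^sub>R jump T F w x))\<^sup>2 \<partial>face_measure F)" for T F w
  define N :: "_ \<Rightarrow> _ \<Rightarrow> (real^'d \<Rightarrow> real) \<times> (real^'d \<Rightarrow> real) \<Rightarrow> real" where "N T F w = (\<integral>x. (norm (?S T *v grad_trace T F (fst w) x))\<^sup>2 \<partial>face_measure F)" for T F w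
  \<comment> \<open>The squared triple norm regrouped by elements, to be compared with the bilinear
    form summand by summand.\<close>
  define Q where "Q w = (\<Sum>T\<in>\<T>. G T w + (\<Sum>F\<in>faces_of \<T> T. J T F w + diameter T * N T F w))" for w
  have nonneg: "0 \<le> G T w" "0 \<le> J T F w" "0 \<le> N T F w" for T F w
    by (simp_all add: G_def J_def N_def)
  have Q: "(triple_norm \<T> \<kappa> k \<alpha>0 \<delta> w)\<^sup>2 = Q w" for w
  proof -
    \<comment> \<open>Nonnegative sums under both roots let the squares cancel the roots in
      \<open>star_norm\<close> and \<open>triple_norm\<close>.\<close>
    have "0 \<le> (\<Sum>T\<in>\<T>. G T w) + (\<Sum>T\<in>\<T>. \<Sum>F\<in>faces_of \<T> T. J T F w)"
      by (intro add_nonneg_nonneg sum_nonneg nonneg)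
    moreover have "0 \<le> (\<Sum>T\<in>\<T>. diameter T * (\<Sum>F\<in>faces_of \<T> T. N T F w))"
      by (intro sum_nonneg mult_nonneg_nonneg nonneg D)
    ultimately have "(triple_norm \<T> \<kappa> k \<alpha>0 \<delta> w)\<^sup>2 = (\<Sum>T\<in>\<T>. G T w) + (\<Sum>T\<in>\<T>. \<Sum>F\<in>faces_of \<T> T. J T F w)
      + (\<Sum>T\<in>\<T>. diameter T * (\<Sum>F\<in>faces_of \<T> T. N T F w))"
      unfolding triple_norm_def star_norm_def G_def[symmetric] J_def[symmetric] N_def[symmetric]
      by simp
    also have "\<dots> = Q w"
      by (simp add: Q_def sum.distrib sum_distrib_left)
    finally show ?thesis .
  qed
  let ?V = "\<lambda>T. \<integral>x. (\<kappa> x *v grad T (fst w) x) \<bullet> grad T (fst v) x \<partial>lebesgue_on (interior T)"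
  let ?I = "\<lambda>T F. (\<integral>x. (?\<tau> T F *\<^sub>R jump T F w x) \<bullet> jump T F v x \<partial>face_measure F)
      - (\<integral>x. (?K T *v grad_trace T F (fst w) x) \<bullet> jump T F v x \<partial>face_measure F)
      - \<epsilon> * (\<integral>x. (?K T *v grad_trace T F (fst v) x) \<bullet> jump T F w x \<partial>face_measure F)"
  have "B_form \<T> \<kappa> k \<alpha>0 \<delta> \<epsilon> w v = (\<Sum>T\<in>\<T>. ?V T + (\<Sum>F\<in>faces_of \<T> T. ?I T F))"
    unfolding B_form_def by (simp only: sum.distrib sum_subtractf sum_distrib_left add_diff_eq)
  also have "\<dots> \<le> (\<Sum>T\<in>\<T>. L / 2 * (t * G T w + G T v / t)
      + (\<Sum>F\<in>faces_of \<T> T. L / 2 * (t * (J T F w + diameter T * N T F w) + (J T F v + diameter T * N T F v) / t)))"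
  proof (intro sum_mono add_mono)
    fix T assume T: "T \<in> \<T>"
    show "?V T \<le> L / 2 * (t * G T w + G T v / t)"
      unfolding G_def using T assms by (intro volume_estimate[where K = "?K T"]) auto
    fix F assume F: "F \<in> faces_of \<T> T"
    then have "F \<in> faces \<T>"
      by (simp add: faces_of_def)
    then show "?I T F \<le> L / 2 * (t * (J T F w + diameter T * N T F w) + (J T F v + diameter T * N T F v) / t)"
      unfolding J_def N_def using \<tau>[OF T F]
      by (intro face_estimate[OF S[OF T] n[OF T F] _ D[OF T] \<tau>0[OF T F]] assms) (auto simp: normal_coeff_def)
  qed
  also have "\<dots> = L / 2 * (t * Q w + Q v / t)"
    by (simp add: Q_def sum.distrib sum_distrib_left sum_divide_distrib distrib_left add_divide_distrib ac_simps)
  finally show ?thesis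
    by (simp add: Q)
qed

section \<open>Size of the penalty\<close>

text \<open>After inserting the penalty, the claim follows from
  \<open>D powr \<delta> \<le> L * A\<close>. The constant \<open>C1\<close> is
  \<open>inverse A\<close> times the factor that compares \<open>D powr \<delta>\<close> with
  \<open>h powr \<delta>\<close>.\<close>

lemma penalty_lower_bound:
  fixes T F :: "(real^'d::finite) set"
  assumes "0 < \<alpha>0" "0 < \<rho>0" "\<rho>0 \<le> 1" "0 < h" "\<rho>0 * h \<le> diameter T" "diameter T \<le> h"
    and C1: "C1 = (if 0 \<le> \<delta> then 1 else \<rho>0 powr \<delta>) * inverse (\<alpha>0 * (C_tr k CARD('d))\<^sup>2)"
    and "0 \<le> normal_coeff \<kappa> T F" "C1 * h powr \<delta> \<le> L"
  shows "normal_coeff \<kappa> T F \<le> L * diameter T * penalty \<kappa> k \<alpha>0 \<delta> T F"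
proof -
  define D A where "D = diameter T" and "A = \<alpha>0 * (C_tr k CARD('d))\<^sup>2"
  have "0 < \<rho>0 * h"
    using assms by simp
  then have D: "0 < D"
    using assms(5) by (simp add: D_def)
  have "0 < C_tr k CARD('d)"
    by (simp add: C_tr_def add_pos_nonneg add_nonneg_pos)
  then have A: "0 < A"
    using assms by (simp add: A_def)
  \<comment> \<open>For negative \<delta> the power decreases in \<open>D\<close>, so the lower
    bound \<open>\<rho>0 * h\<close> of quasi-uniformity takes over from \<open>D \<le> h\<close>
    and contributes \<open>\<rho>0 powr \<delta>\<close>.\<close>
  have "D powr \<delta> \<le> (if 0 \<le> \<delta> then 1 else \<rho>0 powr \<delta>) * h powr \<delta>"
  proof (cases "0 \<le> \<delta>")
    case True
    then show ?thesis
      using assms D by (auto simp: D_def intro: powr_mono2)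
  next
    case False
    then have "D powr \<delta> \<le> (\<rho>0 * h) powr \<delta>"
      using assms \<open>0 < \<rho>0 * h\<close> by (auto simp: D_def intro: powr_mono2')
    then show ?thesis
      using False assms by (simp add: powr_mult)
  qed
  then have "D powr \<delta> \<le> C1 * h powr \<delta> * A"
    using A by (simp add: C1 A_def[symmetric] mult.assoc mult.left_commute[of "inverse A"])
  also have "\<dots> \<le> L * A"
    using assms A by (intro mult_right_mono) auto
  finally have "normal_coeff \<kappa> T F * D powr \<delta> \<le> normal_coeff \<kappa> T F * (L * A)"
    using assms by (intro mult_left_mono)
  then have "normal_coeff \<kappa> T F \<le> L * A * normal_coeff \<kappa> T F / D powr \<delta>"
    using D by (simp add: field_simps)
  also have "\<dots> = L * D * (A * normal_coeff \<kappa> T F / D powr (1 + \<delta>))"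
    using D by (simp add: powr_add)
  finally show ?thesis
    by (simp add: penalty_def D_def A_def)
qed

section \<open>Boundedness of the bilinear form\<close>

theorem lemma3p5:
  fixes \<Omega> :: "(real^'d::finite) set"
    and \<kappa> :: "real^'d \<Rightarrow> real^'d^'d"
    and H :: "real set"
    and \<T> :: "real \<Rightarrow> (real^'d) set set"
    and \<rho>0 s \<alpha>0 \<delta> \<epsilon> C1 :: real
    and k :: nat
  assumes "2 \<le> CARD('d)"
    and "polyhedral_lipschitz_domain \<Omega>"
    and "coefficient \<Omega> \<kappa>"
    and "mesh_family \<Omega> H \<T>"
    and "shape_regular H \<T>"
    and "quasi_uniform \<rho>0 H \<T>"
    and "\<forall>h\<in>H. piecewise_constant (\<T> h) \<kappa>"
    and "3/2 < s"
    and "0 < \<alpha>0"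
    and "\<epsilon> \<in> {0, 1, -1}"
    and C1: "C1 = (if 0 \<le> \<delta> then 1 else \<rho>0 powr \<delta>) * inverse (\<alpha>0 * (C_tr k CARD('d))\<^sup>2)"
  shows "\<forall>h\<in>H. \<exists>Cbnd>0. Cbnd = max 2 (C1 * h powr \<delta>) \<and>
           (\<forall>w \<in> V_star s k \<Omega> (\<T> h). \<forall>v \<in> V_star s k \<Omega> (\<T> h).
              B_form (\<T> h) \<kappa> k \<alpha>0 \<delta> \<epsilon> w v
                \<le> Cbnd * triple_norm (\<T> h) \<kappa> k \<alpha>0 \<delta> w * triple_norm (\<T> h) \<kappa> k \<alpha>0 \<delta> v)"
proof
  fix h assume h: "h \<in> H"
  define L where "L = max 2 (C1 * h powr \<delta>)"
  have L: "2 \<le> L" "C1 * h powr \<delta> \<le> L" "0 < L"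
    by (auto simp: L_def)
  have mesh: "simplicial_mesh \<Omega> (\<T> h)" "0 < h"
    using assms(4) h by (auto simp: mesh_family_def)
  have qu: "0 < \<rho>0" "\<rho>0 \<le> 1" "\<And>T. T \<in> \<T> h \<Longrightarrow> \<rho>0 * h \<le> diameter T \<and> diameter T \<le> h"
    using assms(6) h by (auto simp: quasi_uniform_def)
  have pc: "piecewise_constant (\<T> h) \<kappa>"
    using assms(7) h by blast
  have \<Omega>: "open \<Omega>" "interior (closure \<Omega>) \<subseteq> \<Omega>"
    using assms(2) interior_closure_Lipschitz by (auto simp: polyhedral_lipschitz_domain_def)
  have T: "convex T" "closed T" "interior T \<noteq> {}" "interior T \<subseteq> \<Omega>" "0 < diameter T" if "T \<in> \<T> h" for T
  proof -
    have *: "int CARD('d) simplex T" "T \<subseteq> closure \<Omega>"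
      using mesh(1) that by (auto simp: simplicial_mesh_def)
    show "convex T" "closed T"
      using * convex_simplex closed_simplex by blast+
    \<comment> \<open>A simplex of full dimension spans the space, so its interior is its relative
      interior.\<close>
    have "affine hull T = UNIV" "T \<noteq> {}"
      using aff_dim_simplex[OF *(1)] by (auto simp flip: aff_dim_eq_full)
    then show "interior T \<noteq> {}"
      using \<open>convex T\<close> rel_interior_eq_empty[of T] by (simp add: rel_interior_interior)
    show "interior T \<subseteq> \<Omega>"
      using interior_mono[OF *(2)] \<Omega> by blast
    have "0 < \<rho>0 * h"
      using qu mesh by simp
    then show "0 < diameter T"
      using qu(3)[OF that] by linarith
  qed
  have S: "(elem_value \<kappa> T *v u) \<bullet> v = (mat_sqrt (elem_value \<kappa> T) *v u) \<bullet> (mat_sqrt (elem_value \<kappa> T) *v v)"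
    if TT: "T \<in> \<T> h" for T u v
  proof -
    obtain m where "transpose (elem_value \<kappa> T) = elem_value \<kappa> T" "0 < m"
      "\<And>\<xi>. m * (norm \<xi>)\<^sup>2 \<le> \<xi> \<bullet> (elem_value \<kappa> T *v \<xi>)"
      using elem_value_spd[OF assms(3) pc TT \<Omega>(1) T(4,3)[OF TT]] by metis
    then show ?thesis
      by (rule mat_sqrt)
  qed
  then have coeff: "0 \<le> normal_coeff \<kappa> T F" if "T \<in> \<T> h" for T F
    using that by (simp add: normal_coeff_def inner_commute[of "outer_normal T F"])
  have n: "norm (outer_normal T F) = 1" if TF: "T \<in> \<T> h" "F \<in> faces_of (\<T> h) T" for T F
  proof -
    \<comment> \<open>\<open>T'\<close> may differ from \<open>T\<close>; it supplies convexity and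
      nonemptiness of \<open>F\<close>.\<close>
    obtain T' where "F facet_of T'" "F \<subseteq> frontier T"
      using TF(2) by (auto simp: faces_of_def faces_def)
    then show ?thesis
      using T TF(1) by (intro outer_normal_unit) (auto simp: facet_of_def intro: face_of_imp_convex)
  qed
  \<comment> \<open>\<open>sqrt\<close> is negative at negative arguments, so the sign of the sum
    under the root has to be checked.\<close>
  have triple_nonneg: "0 \<le> triple_norm (\<T> h) \<kappa> k \<alpha>0 \<delta> u" for u
    using less_imp_le[OF T(5)] unfolding triple_norm_def
      by (intro real_sqrt_ge_zero add_nonneg_nonneg zero_le_power2 sum_nonneg mult_nonneg_nonneg) auto
  have "B_form (\<T> h) \<kappa> k \<alpha>0 \<delta> \<epsilon> w v
      \<le> L * triple_norm (\<T> h) \<kappa> k \<alpha>0 \<delta> w * triple_norm (\<T> h) \<kappa> k \<alpha>0 \<delta> v"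
    if wv: "w \<in> V_star s k \<Omega> (\<T> h)" "v \<in> V_star s k \<Omega> (\<T> h)" for w v
  proof (rule le_mult_if_le_weighted)
    fix t :: real assume "0 < t"
    show "B_form (\<T> h) \<kappa> k \<alpha>0 \<delta> \<epsilon> w v \<le> L / 2 * (t * (triple_norm (\<T> h) \<kappa> k \<alpha>0 \<delta> w)\<^sup>2
        + (triple_norm (\<T> h) \<kappa> k \<alpha>0 \<delta> v)\<^sup>2 / t)"
    proof (rule B_form_weighted)
      fix T F assume TF: "T \<in> \<T> h"
      show "normal_coeff \<kappa> T F \<le> L * diameter T * penalty \<kappa> k \<alpha>0 \<delta> T F"
        using qu TF mesh coeff L assms(9) by (intro penalty_lower_bound[OF _ _ _ _ _ _ C1]) auto
      show "0 \<le> penalty \<kappa> k \<alpha>0 \<delta> T F"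
        using coeff[OF TF] assms(9) by (simp add: penalty_def)
    qed (use elem_value_AE[OF pc] S n T L \<open>0 < t\<close> assms(10) V_star_snd_L2[OF wv(1)] V_star_snd_L2[OF wv(2)] in \<open>auto intro: less_imp_le\<close>)
  qed (use L triple_nonneg in auto)
  then show "\<exists>Cbnd>0. Cbnd = max 2 (C1 * h powr \<delta>) \<and>
           (\<forall>w \<in> V_star s k \<Omega> (\<T> h). \<forall>v \<in> V_star s k \<Omega> (\<T> h).
              B_form (\<T> h) \<kappa> k \<alpha>0 \<delta> \<epsilon> w v
                \<le> Cbnd * triple_norm (\<T> h) \<kappa> k \<alpha>0 \<delta> w * triple_norm (\<T> h) \<kappa> k \<alpha>0 \<delta> v)"
    using L(3) unfolding L_def by blast
qed

end
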